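(* Let $k\ge 1$, let $\mathbf{P}$ be a probability distribution on $\mathbb{Z}_{\ge 0}^k$, and let $q_1,\dots,q_k\in(0,1)$. Then the following three conditions are equivalent. (i) For every $n=(n_1,\dots,n_k)\in\mathbb{Z}_{\ge 0}^k$ and every $j\in\{1,\dots,k\}$, $$\mathbf{P}\big((n+e_j)^+\,\big|\,n^+\big)=q_j .$$ (ii) For every $n=(n_1,\dots,n_k)\in\mathbb{Z}_{\ge 0}^k$ and every $j\in\{1,\dots,k\}$, $$\mathbf{P}(n_1,\dots,n_{j-1},n_j+1,n_{j+1},\dots,n_k)=q_j\,\mathbf{P}(n_1,\dots,n_{j-1},n_j,n_{j+1},\dots,n_k).$$ (iii) For every $n=(n_1,\dots,n_k)\in\mathbb{Z}_{\ge 0}^k$, $$\mathbf{P}(n_1,\dots,n_k)=\prod_{j=1}^k\big[q_j^{n_j}(1-q_j)\big],$$ that is, $(n_1,\dots,n_k)$ is a random vector with independent geometrically distributed coordinates.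
   Context: $\mathbb{Z}_{\ge 0}^k$ is the set of vectors $n=(n_1,\dots,n_k)$ of non-negative integers ($n_j$ is the number of particles in state $j$). $\mathbf{P}(n)=\mathbf{P}(n_1,\dots,n_k)$ denotes the probability of the single point $n$. The vector $e_j$ is the $j$th unit coordinate vector (with $j$th coordinate $1$ and all other coordinates $0$). For $n\in\mathbb{Z}_{\ge 0}^k$, $n^+=(n_1,\dots,n_k)^+$ denotes the event $\{m\in\mathbb{Z}_{\ge 0}^k : m_j\ge n_j \text{ for all } j=1,\dots,k\}$. Here $\mathbf{P}(A|B)=\mathbf{P}(A\cap B)/\mathbf{P}(B)$ is the usual conditional probability. Condition (i) includes the requirement that the conditioning events have positive probability. *)

theory Defs
  imports "HOL-Probability.Probability"
begin

text \<open>
  The points of $Z_{\ge 0}^k$ are the vectors of type \<^typ>\<open>nat ^ 'k\<close> with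
  \<open>k = CARD('k)\<close>, so that \<open>k \<ge> 1\<close> holds automatically, and the unit coordinate vector
  $e_j$ is \<^term>\<open>axis j (1 :: nat)\<close>.

  \<open>upper_orthant n\<close> is the event written $n^+$.
\<close>

definition upper_orthant :: "nat ^ 'k::finite \<Rightarrow> (nat ^ 'k) set" where
  "upper_orthant n = {m. \<forall>j. m $ j \<ge> n $ j}"

end

theory Submission
  imports Defs
begin

text \<open>
  Condition (ii) is a first-order recurrence in each coordinate separately, so a solution is
  determined by its value at \<open>0\<close> (\<open>multiplicative_vec_eq\<close>). The product of geometric
  distributions is one solution, and two proportional probability mass functions are equal;
  hence (ii) forces (iii).

  Conditions (i) and (ii) say that the same recurrence holds for the tail function
  \<open>n \<mapsto> P(n\<^sup>+)\<close> and for the mass function. Summation of the mass function over an orthant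
  carries the recurrence from masses to tails, because translation by \<open>e\<^sub>j\<close> maps \<open>n\<^sup>+\<close>
  bijectively onto \<open>(n + e\<^sub>j)\<^sup>+\<close>. In the other direction, the mass at \<open>n\<close> is a \<open>k\<close>-fold
  mixed difference of the tail function. The differences are taken one coordinate at a time,
  through the events in which the coordinates in a set \<open>S\<close> are prescribed exactly and the
  others are only bounded below; a difference of two solutions of the recurrence is again a
  solution, so an induction on \<open>S\<close> leads from the tails (\<open>S = {}\<close>) to the masses
  (\<open>S = UNIV\<close>); this is \<open>prob_orthant_face_step\<close>.

  Finally, a joint mass function factorises into the given marginal mass functions exactly when
  the coordinates are independent with these marginals; \<open>pmf_vec_eq_prod_iff_indep\<close> gives this
  for arbitrary marginals on an arbitrary type.
\<close>

section \<open>Functions that are multiplicative in each coordinate\<close>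

text \<open>
  Every vector is reached from \<open>0\<close> by finitely many unit steps, so induction on the sum of the
  coordinates applies.
\<close>

lemma multiplicative_vec_eq:
  fixes f :: "nat ^ 'k::finite \<Rightarrow> 'a::comm_semiring_1"
  assumes step: "\<And>n j. f (n + axis j 1) = q j * f n"
  shows "f n = (\<Prod>j\<in>UNIV. q j ^ (n $ j)) * f 0"
proof (induction "\<Sum>j\<in>UNIV. n $ j" arbitrary: n)
  case 0
  then have "n = 0"
    by (simp add: vec_eq_iff)
  then show ?case
    by simp
next
  case (Suc s)
  have "(\<Sum>j\<in>UNIV. n $ j) \<noteq> 0"
    using Suc.hyps(2) by linarith
  then obtain i where i: "n $ i \<noteq> 0"
    by (rule sum.not_neutral_contains_not_neutral)
  define m where "m = n - axis i 1"
  have n: "n = m + axis i 1"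
    using i by (auto simp: m_def vec_eq_iff axis_def)
  have "(\<Sum>j\<in>UNIV. n $ j) = (\<Sum>j\<in>UNIV. m $ j) + 1"
    by (simp add: n sum.distrib axis_def)
  with Suc.hyps have "f m = (\<Prod>j\<in>UNIV. q j ^ (m $ j)) * f 0"
    by simp
  moreover have "(\<Prod>j\<in>UNIV. q j ^ (n $ j)) = q i * (\<Prod>j\<in>UNIV. q j ^ (m $ j))"
  proof -
    have "q j ^ (n $ j) = (if j = i then q i else 1) * q j ^ (m $ j)" for j
      by (simp add: n axis_def)
    then show ?thesis
      by (simp add: prod.distrib)
  qed
  ultimately show ?case
    using step[of m i] by (simp add: n mult.assoc)
qed

section \<open>Tail probabilities and point probabilities\<close>

lemma upper_orthant_0 [simp]: "upper_orthant 0 = UNIV"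
  by (simp add: upper_orthant_def)

lemma upper_orthant_add_axis_subset: "upper_orthant (n + axis j 1) \<subseteq> upper_orthant n"
  by (auto simp: upper_orthant_def intro: add_leD1)

lemma upper_orthant_add_axis_eq_image:
  fixes n :: "nat ^ 'k::finite"
  shows "upper_orthant (n + axis j 1) = (\<lambda>m. m + axis j 1) ` upper_orthant n"
proof (intro equalityI subsetI)
  fix m assume m: "m \<in> upper_orthant (n + axis j 1)"
  then have bound: "n $ i + axis j 1 $ i \<le> m $ i" for i
    by (simp add: upper_orthant_def)
  have "axis j 1 $ i \<le> m $ i" for i
    using bound[of i] by linarith
  then have "m = (m - axis j 1) + axis j 1"
    by (simp add: vec_eq_iff)
  moreover have "n $ i \<le> m $ i - axis j 1 $ i" for i
    using bound[of i] by linarith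
  then have "m - axis j 1 \<in> upper_orthant n"
    by (simp add: upper_orthant_def)
  ultimately show "m \<in> (\<lambda>m. m + axis j 1) ` upper_orthant n"
    by blast
qed (auto simp: upper_orthant_def)

lemma prob_upper_orthant_step:
  fixes P :: "(nat ^ 'k::finite) pmf"
  assumes step: "\<And>n. pmf P (n + axis j 1) = c * pmf P n"
  shows "measure_pmf.prob P (upper_orthant (n + axis j 1))
           = c * measure_pmf.prob P (upper_orthant n)"
proof -
  have "measure_pmf.prob P (upper_orthant (n + axis j 1))
          = infsetsum (\<lambda>m. pmf P (m + axis j 1)) (upper_orthant n)"
    unfolding measure_pmf_conv_infsetsum upper_orthant_add_axis_eq_image
    by (subst infsetsum_reindex) (auto simp: inj_on_def)
  also have "\<dots> = c * infsetsum (pmf P) (upper_orthant n)"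
    unfolding step by (simp add: infsetsum_cmult_right pmf_abs_summable)
  finally show ?thesis
    by (simp add: measure_pmf_conv_infsetsum)
qed

text \<open>
  These events interpolate between the orthant \<open>n\<^sup>+\<close> and the point \<open>n\<close> as \<open>S\<close> grows from
  \<open>{}\<close> to \<open>UNIV\<close>.
\<close>

definition orthant_face :: "'k set \<Rightarrow> nat ^ 'k::finite \<Rightarrow> (nat ^ 'k) set" where
  "orthant_face S n = {m \<in> upper_orthant n. \<forall>j\<in>S. m $ j = n $ j}"

text \<open>
  The condition \<open>m $ i = n $ i\<close> is the difference of the conditions \<open>m $ i \<ge> n $ i\<close> and
  \<open>m $ i \<ge> n $ i + 1\<close>.
\<close>

lemma prob_orthant_face_insert:
  assumes "i \<notin> S"
  shows "measure_pmf.prob P (orthant_face (insert i S) n)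
           = measure_pmf.prob P (orthant_face S n)
             - measure_pmf.prob P (orthant_face S (n + axis i 1))"
proof -
  have orthant: "m \<in> upper_orthant (n + axis i 1) \<longleftrightarrow> m \<in> upper_orthant n \<and> m $ i \<noteq> n $ i" for m
  proof (intro iffI)
    assume "m \<in> upper_orthant (n + axis i 1)"
    then have *: "n $ j + axis i 1 $ j \<le> m $ j" for j
      by (simp add: upper_orthant_def)
    show "m \<in> upper_orthant n \<and> m $ i \<noteq> n $ i"
      using *[of i] add_leD1[OF *] by (simp add: upper_orthant_def)
  next
    assume *: "m \<in> upper_orthant n \<and> m $ i \<noteq> n $ i"
    have "n $ j + axis i 1 $ j \<le> m $ j" for j
      using * by (cases "j = i") (auto simp: upper_orthant_def axis_def Suc_le_eq less_le)
    then show "m \<in> upper_orthant (n + axis i 1)"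
      by (simp add: upper_orthant_def)
  qed
  have "(n + axis i 1) $ j = n $ j" if "j \<in> S" for j
    using that assms by (auto simp: axis_def)
  then have shifted:
    "m \<in> orthant_face S (n + axis i 1) \<longleftrightarrow> m \<in> orthant_face S n \<and> m $ i \<noteq> n $ i" for m
    by (auto simp: orthant_face_def orthant simp del: One_nat_def vector_add_component)
  have "orthant_face (insert i S) n = orthant_face S n - orthant_face S (n + axis i 1)"
    by (auto simp: set_eq_iff shifted simp del: One_nat_def) (auto simp: orthant_face_def)
  moreover have "orthant_face S (n + axis i 1) \<subseteq> orthant_face S n"
    using shifted by blast
  ultimately show ?thesis
    by (simp add: measure_pmf.finite_measure_Diff)
qed

text \<open>
  Taking the difference in direction \<open>i\<close> commutes with the shift by \<open>e\<^sub>j\<close>, so the recurrence for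
  \<open>S\<close> passes to \<open>insert i S\<close>.
\<close>

lemma prob_orthant_face_step:
  fixes P :: "(nat ^ 'k::finite) pmf"
  assumes step: "\<And>n. measure_pmf.prob P (upper_orthant (n + axis j 1))
                       = c * measure_pmf.prob P (upper_orthant n)"
  shows "measure_pmf.prob P (orthant_face S (n + axis j 1))
           = c * measure_pmf.prob P (orthant_face S n)"
proof -
  have "finite S"
    by simp
  then show ?thesis
  proof (induction S arbitrary: n)
    case empty
    show ?case
      using step by (simp add: orthant_face_def)
  next
    case (insert i S)
    have "n + axis j 1 + axis i 1 = n + axis i 1 + axis j 1"
      by (simp add: add_ac)
    then show ?case
      using insert.IH[of n] insert.IH[of "n + axis i 1"]
      by (simp add: prob_orthant_face_insert[OF insert.hyps(2)] right_diff_distrib)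
  qed
qed

lemma pmf_step_iff_prob_upper_orthant_step:
  fixes P :: "(nat ^ 'k::finite) pmf"
  shows "(\<forall>n. pmf P (n + axis j 1) = c * pmf P n)
     \<longleftrightarrow> (\<forall>n. measure_pmf.prob P (upper_orthant (n + axis j 1))
               = c * measure_pmf.prob P (upper_orthant n))"
proof
  have "orthant_face UNIV n = {n}" for n :: "nat ^ 'k"
    by (auto simp: orthant_face_def upper_orthant_def vec_eq_iff)
  then have face: "measure_pmf.prob P (orthant_face UNIV n) = pmf P n" for n
    by (simp add: measure_pmf_single)
  assume "\<forall>n. measure_pmf.prob P (upper_orthant (n + axis j 1))
                = c * measure_pmf.prob P (upper_orthant n)"
  then show "\<forall>n. pmf P (n + axis j 1) = c * pmf P n"
    using prob_orthant_face_step[of P j c UNIV] by (simp add: face)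
qed (use prob_upper_orthant_step in blast)

text \<open>
  The tail function equals \<open>1\<close> at \<open>0\<close>, so under the recurrence it is a product of powers of the
  \<open>q j\<close>; this is why all conditioning events have positive probability.
\<close>

lemma cond_prob_upper_orthant_iff_pmf_step:
  fixes P :: "(nat ^ 'k::finite) pmf" and q :: "'k \<Rightarrow> real"
  assumes q: "\<And>j. q j > 0"
  shows "(\<forall>n j. measure_pmf.prob P (upper_orthant n) > 0 \<and>
            \<P>(m in measure_pmf P. m \<in> upper_orthant (n + axis j 1) \<bar> m \<in> upper_orthant n) = q j)
     \<longleftrightarrow> (\<forall>n j. pmf P (n + axis j 1) = q j * pmf P n)"
proof -
  let ?G = "\<lambda>n. measure_pmf.prob P (upper_orthant n)"
  have cond: "\<P>(m in measure_pmf P. m \<in> upper_orthant (n + axis j 1) \<bar> m \<in> upper_orthant n)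
                = ?G (n + axis j 1) / ?G n" for n j
  proof -
    have "{m. m \<in> upper_orthant (n + axis j 1) \<and> m \<in> upper_orthant n} = upper_orthant (n + axis j 1)"
      using upper_orthant_add_axis_subset[of n j] by blast
    then show ?thesis
      by (simp add: cond_prob_def)
  qed
  have "(\<forall>n j. ?G n > 0 \<and> ?G (n + axis j 1) / ?G n = q j)
          \<longleftrightarrow> (\<forall>n j. ?G (n + axis j 1) = q j * ?G n)"
  proof (intro iffI allI)
    fix n j
    assume "\<forall>n j. ?G n > 0 \<and> ?G (n + axis j 1) / ?G n = q j"
    then have "?G n > 0" "?G (n + axis j 1) / ?G n = q j"
      by blast+
    then show "?G (n + axis j 1) = q j * ?G n"
      by (simp add: field_simps)
  next
    fix n j
    assume step: "\<forall>n j. ?G (n + axis j 1) = q j * ?G n"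
    then have "?G n = (\<Prod>j\<in>UNIV. q j ^ (n $ j)) * ?G 0"
      by (intro multiplicative_vec_eq) blast
    then have "?G n > 0"
      by (simp add: prod_pos q measure_pmf.prob_space[simplified])
    with step show "?G n > 0 \<and> ?G (n + axis j 1) / ?G n = q j"
      by simp
  qed
  then show ?thesis
    unfolding cond using pmf_step_iff_prob_upper_orthant_step[of P _ "q _"] by blast
qed

section \<open>Product distributions on vectors\<close>

definition vec_pmf :: "('k \<Rightarrow> 'a pmf) \<Rightarrow> ('a ^ 'k::finite) pmf" where
  "vec_pmf p = map_pmf vec_lambda (Pi_pmf UNIV undefined p)"

lemma pmf_vec_pmf: "pmf (vec_pmf p) n = (\<Prod>j\<in>UNIV. pmf (p j) (n $ j))"
proof -
  have "inj (vec_lambda :: ('k \<Rightarrow> 'a) \<Rightarrow> 'a ^ 'k)"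
    by (metis injI vec_lambda_inverse UNIV_I)
  then have "pmf (vec_pmf p) (vec_lambda (($) n)) = pmf (Pi_pmf UNIV undefined p) (($) n)"
    unfolding vec_pmf_def by (rule pmf_map_inj')
  then show ?thesis
    by (simp add: pmf_Pi vec_nth_inverse)
qed

lemma map_pmf_nth_vec_pmf: "map_pmf (\<lambda>n. n $ j) (vec_pmf p) = p j"
proof -
  have "map_pmf (\<lambda>n. n $ j) (vec_pmf p) = map_pmf (\<lambda>f. f j) (Pi_pmf UNIV undefined p)"
    by (simp add: vec_pmf_def map_pmf_comp)
  then show ?thesis
    by (simp add: Pi_pmf_component)
qed

lemma indep_vars_map_pmf:
  fixes p :: "'a pmf" and X :: "'i \<Rightarrow> 'b \<Rightarrow> 'c"
  assumes indep: "prob_space.indep_vars (measure_pmf p) (\<lambda>_. count_space UNIV) (\<lambda>i x. X i (f x)) I"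
  shows "prob_space.indep_vars (measure_pmf (map_pmf f p)) (\<lambda>_. count_space UNIV) X I"
proof -
  have "measure_pmf.prob (map_pmf f p) (\<Inter>j\<in>J. A j) = (\<Prod>j\<in>J. measure_pmf.prob (map_pmf f p) (A j))"
    if J: "J \<subseteq> I" "J \<noteq> {}" "finite J"
      and A: "\<And>j. j \<in> J \<Longrightarrow> \<exists>B. A j = X j -` B" for J A
  proof -
    from A obtain B where B: "\<And>j. j \<in> J \<Longrightarrow> A j = X j -` B j"
      by metis
    have vimage: "f -` (X j -` C) = (\<lambda>x. X j (f x)) -` C" for j C
      by auto
    have "measure_pmf.prob (map_pmf f p) (\<Inter>j\<in>J. A j)
            = measure_pmf.prob p (\<Inter>j\<in>J. (\<lambda>x. X j (f x)) -` B j)"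
      using B by (auto intro!: arg_cong[where f = "measure_pmf.prob p"])
    also have "\<dots> = (\<Prod>j\<in>J. measure_pmf.prob p ((\<lambda>x. X j (f x)) -` B j))"
      using prob_space.indep_varsD[OF measure_pmf.prob_space_axioms indep, of J B] J by simp
    also have "\<dots> = (\<Prod>j\<in>J. measure_pmf.prob (map_pmf f p) (A j))"
      using B by (intro prod.cong) (simp_all add: vimage)
    finally show ?thesis .
  qed
  then have "prob_space.indep_sets (measure_pmf (map_pmf f p)) (\<lambda>i. {X i -` B |B. True}) I"
    unfolding prob_space.indep_sets_def[OF measure_pmf.prob_space_axioms]
    by (simp add: Pi_iff)
  then show ?thesis
    unfolding prob_space.indep_vars_def2[OF measure_pmf.prob_space_axioms] by simp
qed

text \<open>
  If the masses factorise, \<open>P\<close> is the product distribution. Conversely, the point \<open>n\<close> is the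
  intersection of the events that prescribe one component each, so independence factorises its
  mass.
\<close>

lemma pmf_vec_eq_prod_iff_indep:
  fixes P :: "('a ^ 'k::finite) pmf"
  shows "(\<forall>n. pmf P n = (\<Prod>j\<in>UNIV. pmf (p j) (n $ j)))
     \<longleftrightarrow> prob_space.indep_vars (measure_pmf P) (\<lambda>_. count_space UNIV) (\<lambda>j n. n $ j) UNIV
         \<and> (\<forall>j. map_pmf (\<lambda>n. n $ j) P = p j)"
    (is "?factorised \<longleftrightarrow> ?indep \<and> ?marginals")
proof (intro iffI)
  assume ?factorised
  then have P: "P = vec_pmf p"
    by (intro pmf_eqI) (simp add: pmf_vec_pmf)
  have "prob_space.indep_vars (measure_pmf (Pi_pmf UNIV undefined p)) (\<lambda>_. count_space UNIV)
          (\<lambda>j f. vec_lambda f $ j) UNIV"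
    using indep_vars_Pi_pmf[of "UNIV :: 'k set" undefined p] by simp
  then have ?indep
    unfolding P vec_pmf_def by (rule indep_vars_map_pmf)
  then show "?indep \<and> ?marginals"
    by (simp add: P map_pmf_nth_vec_pmf)
next
  assume *: "?indep \<and> ?marginals"
  show ?factorised
  proof
    fix n :: "'a ^ 'k"
    have "{n} = (\<Inter>j. (\<lambda>m. m $ j) -` {n $ j})"
      by (auto simp: vec_eq_iff)
    then have "pmf P n = measure_pmf.prob P (\<Inter>j. (\<lambda>m. m $ j) -` {n $ j})"
      by (metis measure_pmf_single)
    also have "\<dots> = (\<Prod>j\<in>UNIV. measure_pmf.prob P ((\<lambda>m. m $ j) -` {n $ j}))"
      using prob_space.indep_varsD[OF measure_pmf.prob_space_axioms conjunct1[OF *],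
          of UNIV "\<lambda>j. {n $ j}"] by simp
    also have "\<dots> = (\<Prod>j\<in>UNIV. pmf (map_pmf (\<lambda>m. m $ j) P) (n $ j))"
      by (simp add: pmf_map)
    finally show "pmf P n = (\<Prod>j\<in>UNIV. pmf (p j) (n $ j))"
      using * by simp
  qed
qed

section \<open>The geometric case\<close>

lemma pmf_eq_if_proportional:
  fixes P Q :: "'a pmf"
  assumes "\<And>x. pmf P x = c * pmf Q x"
  shows "P = Q"
proof -
  have "1 = infsetsum (\<lambda>x. c * pmf Q x) UNIV"
    using infsetsum_pmf_eq_1[of P UNIV] assms by simp
  also have "\<dots> = c"
    by (simp add: infsetsum_cmult_right pmf_abs_summable infsetsum_pmf_eq_1)
  finally show ?thesis
    using assms by (intro pmf_eqI) simp
qed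

theorem proposition2p1:
  fixes P :: "(nat ^ 'k::finite) pmf" and q :: "'k \<Rightarrow> real"
  assumes q: "\<And>j. q j \<in> {0<..<1}"
  shows "((\<forall>n j. measure_pmf.prob P (upper_orthant n) > 0 \<and>
              \<P>(m in measure_pmf P. m \<in> upper_orthant (n + axis j 1) \<bar> m \<in> upper_orthant n) = q j)
           \<longleftrightarrow> (\<forall>n j. pmf P (n + axis j 1) = q j * pmf P n))
       \<and> ((\<forall>n j. pmf P (n + axis j 1) = q j * pmf P n)
           \<longleftrightarrow> (\<forall>n. pmf P n = (\<Prod>j\<in>UNIV. q j ^ (n $ j) * (1 - q j))))
       \<and> ((\<forall>n. pmf P n = (\<Prod>j\<in>UNIV. q j ^ (n $ j) * (1 - q j)))
           \<longleftrightarrow> prob_space.indep_vars (measure_pmf P) (\<lambda>_. count_space UNIV) (\<lambda>j n. n $ j) UNIV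
               \<and> (\<forall>j. map_pmf (\<lambda>n. n $ j) P = geometric_pmf (1 - q j)))"
proof -
  let ?p = "\<lambda>j. geometric_pmf (1 - q j)"
  have q01: "0 < q j" "q j < 1" for j
    using q[of j] by auto
  have p: "pmf (?p j) i = q j ^ i * (1 - q j)" for j i
    using q01[of j] by simp
  have i_iff_ii: "(\<forall>n j. measure_pmf.prob P (upper_orthant n) > 0 \<and>
      \<P>(m in measure_pmf P. m \<in> upper_orthant (n + axis j 1) \<bar> m \<in> upper_orthant n) = q j)
    \<longleftrightarrow> (\<forall>n j. pmf P (n + axis j 1) = q j * pmf P n)"
    using q01(1) by (rule cond_prob_upper_orthant_iff_pmf_step)
  have ii_iff_iii: "(\<forall>n j. pmf P (n + axis j 1) = q j * pmf P n)
    \<longleftrightarrow> (\<forall>n. pmf P n = (\<Prod>j\<in>UNIV. q j ^ (n $ j) * (1 - q j)))" (is "?ii \<longleftrightarrow> ?iii")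
  proof
    assume ?ii
    then have P: "pmf P n = (\<Prod>j\<in>UNIV. q j ^ (n $ j)) * pmf P 0" for n
      by (intro multiplicative_vec_eq) blast
    define C where "C = (\<Prod>j\<in>UNIV. 1 - q j)"
    have Q: "pmf (vec_pmf ?p) n = (\<Prod>j\<in>UNIV. q j ^ (n $ j)) * C" for n
      by (simp only: pmf_vec_pmf p prod.distrib C_def)
    \<comment> \<open>\<open>C\<close> is the mass of the product distribution at \<open>0\<close>, so the factor between the two
      distributions is the quotient of their masses at \<open>0\<close>.\<close>
    have "C > 0"
      unfolding C_def using q01 by (intro prod_pos) simp
    then have "pmf P n = (pmf P 0 / C) * pmf (vec_pmf ?p) n" for n
      by (subst P) (simp add: Q)
    then have "P = vec_pmf ?p"
      by (rule pmf_eq_if_proportional)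
    then show ?iii
      by (simp only: pmf_vec_pmf p simp_thms)
  next
    assume iii: ?iii
    show ?ii
    proof (intro allI)
      fix n j
      have shift: "q i ^ ((n + axis j 1) $ i) * (1 - q i)
              = (if i = j then q j else 1) * (q i ^ (n $ i) * (1 - q i))" for i
        by (simp add: axis_def)
      have "pmf P (n + axis j 1)
              = (\<Prod>i\<in>UNIV. if i = j then q j else 1)
                * (\<Prod>i\<in>UNIV. q i ^ (n $ i) * (1 - q i))"
        unfolding iii[rule_format] shift by (rule prod.distrib)
      also have "\<dots> = q j * pmf P n"
        unfolding iii[rule_format] by simp
      finally show "pmf P (n + axis j 1) = q j * pmf P n" .
    qed
  qed
  show ?thesis
    using i_iff_ii ii_iff_iii pmf_vec_eq_prod_iff_indep[of P ?p] unfolding p by blast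
qed

end
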